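(* Let $\mathcal{A}=\{a_1,\ldots,a_n\}\subset\mathbb{Z}^d$ generate a pointed affine semigroup. Any Gröbner degeneration of the Lawrence ideal $I_{\Lambda(\mathcal{A})}\subset\mathbb{K}[x_1,\ldots,x_n,y_1,\ldots,y_n]$ is uniquely presented; that is, for every $w\in\mathbb{N}^{2n}$, the ideal $I_{\Lambda(\mathcal{A})}(t,w)\subset\mathbb{K}[x_1,\ldots,x_n,y_1,\ldots,y_n,t]$ has a unique minimal generating set of binomials, up to scalar multiplication.
   Context: $\mathbb{N}$ contains $0$ and $\mathbb{K}$ is a field. An affine semigroup is a finitely generated submonoid $S$ of $\mathbb{Z}^d$ such that the group generated by $S$ is $\mathbb{Z}^d$; it is pointed if $S\cap(-S)=\{0\}$. The Lawrence ideal of $\mathcal{A}$ is the ideal of $\mathbb{K}[x_1,\ldots,x_n,y_1,\ldots,y_n]$ $$I_{\Lambda(\mathcal{A})}:=\Big\langle x^uy^v-x^vy^u\ \Big|\ u,v\in\mathbb{N}^n,\ \sum_{i=1}^nu_ia_i=\sum_{i=1}^nv_ia_i\Big\rangle.$$ Gröbner degeneration: for a polynomial ring $\mathbb{K}[X_1,\ldots,X_N]$, $w\in\mathbb{N}^N$ and a nonzero $f=\sum c_uX^u$, let $d(f):=\max\{w\cdot u\mid c_u\neq0\}$ and $f_t:=t^{d(f)}f(t^{-w_1}X_1,\ldots,t^{-w_N}X_N)$ (with $0_t=0$). For an ideal $J$, the Gröbner degeneration is $J(t,w):=\langle f_t\mid f\in J\rangle\subset\mathbb{K}[X_1,\ldots,X_N,t]$.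 Here $N=2n$ and the variables are $x_1,\ldots,x_n,y_1,\ldots,y_n$. *)

theory Defs
  imports "HOL-Analysis.Finite_Cartesian_Product" "HOL-Library.Poly_Mapping"
begin

type_synonym ('v, 'k) mpoly = "('v \<Rightarrow>\<^sub>0 nat) \<Rightarrow>\<^sub>0 'k"

text \<open>A commutative ring as a module over itself: \<open>ideal.span B\<close> is the ideal generated by \<open>B\<close>.\<close>

global_interpretation ideal: module "(*) :: 'a::comm_ring_1 \<Rightarrow> 'a \<Rightarrow> 'a"
  by unfold_locales (simp_all add: algebra_simps)


section \<open>Affine semigroups\<close>

definition add_submonoid :: "'a::monoid_add set \<Rightarrow> bool" where
  "add_submonoid S \<longleftrightarrow> 0 \<in> S \<and> (\<forall>x\<in>S. \<forall>y\<in>S. x + y \<in> S)"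

definition add_subgroup :: "'a::group_add set \<Rightarrow> bool" where
  "add_subgroup S \<longleftrightarrow> add_submonoid S \<and> (\<forall>x\<in>S. - x \<in> S)"

definition affine_semigroup :: "(int ^ 'd) set \<Rightarrow> bool" where
  "affine_semigroup S \<longleftrightarrow>
     (\<exists>F. finite F \<and> S = add_submonoid hull F) \<and> add_subgroup hull S = UNIV"

definition pointed :: "'a::group_add set \<Rightarrow> bool" where
  "pointed S \<longleftrightarrow> S \<inter> uminus ` S = {0}"


section \<open>Lawrence ideals\<close>

text \<open>The variable \<open>x\<^sub>i\<close> is \<open>Inl i\<close> and \<open>y\<^sub>i\<close> is \<open>Inr i\<close>; \<open>xy_monomial u v\<close> is
  \<open>x\<^sup>u y\<^sup>v\<close>.\<close>

definition xy_monomial :: "('n::finite \<Rightarrow> nat) \<Rightarrow> ('n \<Rightarrow> nat) \<Rightarrow> ('n + 'n, 'k::comm_ring_1) mpoly" where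
  "xy_monomial u v = Poly_Mapping.single
     ((\<Sum>i\<in>UNIV. Poly_Mapping.single (Inl i) (u i)) + (\<Sum>i\<in>UNIV. Poly_Mapping.single (Inr i) (v i))) 1"

definition lawrence_ideal :: "('n::finite \<Rightarrow> int ^ 'd) \<Rightarrow> ('n + 'n, 'k::comm_ring_1) mpoly set" where
  "lawrence_ideal a = ideal.span
     {xy_monomial u v - xy_monomial v u | u v :: 'n \<Rightarrow> nat.
        (\<Sum>i\<in>UNIV. int (u i) *s a i) = (\<Sum>i\<in>UNIV. int (v i) *s a i)}"


section \<open>Groebner degenerations\<close>

definition exponent_weight :: "('v::finite \<Rightarrow> nat) \<Rightarrow> ('v \<Rightarrow>\<^sub>0 nat) \<Rightarrow> nat" where
  "exponent_weight w u = (\<Sum>i\<in>UNIV. w i * Poly_Mapping.lookup u i)"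

definition max_weight :: "('v::finite \<Rightarrow> nat) \<Rightarrow> ('v, 'k::zero) mpoly \<Rightarrow> nat" where
  "max_weight w f = Max (exponent_weight w ` Poly_Mapping.keys f)"

text \<open>The polynomial ring with the additional variable \<open>t\<close> has variables of type \<open>'v option\<close>:
  \<open>None\<close> is \<open>t\<close> and \<open>Some i\<close> is \<open>X\<^sub>i\<close>; \<open>Xt_exponent u k\<close> is the exponent of \<open>X\<^sup>u t\<^sup>k\<close>.\<close>

definition Xt_exponent :: "('v::finite \<Rightarrow>\<^sub>0 nat) \<Rightarrow> nat \<Rightarrow> ('v option \<Rightarrow>\<^sub>0 nat)" where
  "Xt_exponent u k =
     (\<Sum>i\<in>UNIV. Poly_Mapping.single (Some i) (Poly_Mapping.lookup u i)) + Poly_Mapping.single None k"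

text \<open>Since \<open>t\<^sup>d f(t\<^bsup>-w\<^esup>X)\<close> has terms \<open>c\<^sub>u t\<^bsup>d - w\<cdot>u\<^esup> X\<^sup>u\<close> with \<open>w\<cdot>u \<le> d\<close> for \<open>d\<close> the maximal
  weight, the subtraction of natural numbers below never truncates. The zero polynomial is sent to
  the empty sum.\<close>

definition homogenize :: "('v::finite \<Rightarrow> nat) \<Rightarrow> ('v, 'k::comm_monoid_add) mpoly \<Rightarrow> ('v option, 'k) mpoly" where
  "homogenize w f = (\<Sum>u\<in>Poly_Mapping.keys f.
     Poly_Mapping.single (Xt_exponent u (max_weight w f - exponent_weight w u)) (Poly_Mapping.lookup f u))"

definition groebner_degeneration ::
    "('v::finite \<Rightarrow> nat) \<Rightarrow> ('v, 'k::comm_ring_1) mpoly set \<Rightarrow> ('v option, 'k) mpoly set" where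
  "groebner_degeneration w J = ideal.span (homogenize w ` J)"


section \<open>Uniquely presented ideals\<close>

definition binomial_poly :: "('v, 'k::zero) mpoly \<Rightarrow> bool" where
  "binomial_poly f \<longleftrightarrow> card (Poly_Mapping.keys f) = 2"

definition minimal_binomial_generators ::
    "('v, 'k::comm_ring_1) mpoly set \<Rightarrow> ('v, 'k) mpoly set \<Rightarrow> bool" where
  "minimal_binomial_generators J B \<longleftrightarrow>
     (\<forall>f\<in>B. binomial_poly f) \<and> ideal.span B = J \<and> (\<forall>B'. B' \<subset> B \<longrightarrow> ideal.span B' \<noteq> J)"

definition scalar_multiples :: "('v, 'k::field) mpoly set \<Rightarrow> ('v, 'k) mpoly set" where
  "scalar_multiples B = {Poly_Mapping.single 0 c * f | c f. c \<noteq> 0 \<and> f \<in> B}"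

text \<open>Two sets of nonzero polynomials consist of the same elements up to nonzero scalars iff their
  sets of nonzero scalar multiples coincide. (Distinct elements of a minimal generating set are never
  proportional, so this yields a bijection between two such sets.)\<close>

definition uniquely_presented :: "('v, 'k::field) mpoly set \<Rightarrow> bool" where
  "uniquely_presented J \<longleftrightarrow>
     (\<exists>B. minimal_binomial_generators J B \<and>
       (\<forall>C. minimal_binomial_generators J C \<longrightarrow> scalar_multiples C = scalar_multiples B))"

end

theory Submission
  imports Defs
begin

text \<open>The degeneration \<open>J\<close> is the kernel of the algebra map
  \<open>x\<^sup>u y\<^sup>v t\<^sup>k \<mapsto> (\<Sum> u\<^sub>i a\<^sub>i, u + v, w\<cdot>(u, v) + k)\<close>, so it is spanned by differences \<open>m - m'\<close> of monomials
  in a common fibre. If \<open>m\<close> and \<open>m'\<close> are coprime, then for each \<open>i\<close> one of them contains the full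
  available power of \<open>x\<^sub>i\<close> and the other none; hence a third point \<open>r\<close> of the fibre lies between \<open>m\<close>
  and \<open>m'\<close> in the sense of the \<open>L\<^sup>1\<close> distance of the \<open>x\<close>-exponents, and \<open>m - m'\<close> is the sum of the
  shorter differences \<open>m - r\<close> and \<open>r - m'\<close>. By induction on this distance \<open>J\<close> is generated by the
  differences of coprime monomials that form a complete fibre, and every generating set of binomials
  contains each of these up to a scalar.\<close>

section \<open>Pushing polynomials forward along a map of exponents\<close>

text \<open>The linear extension of \<open>h\<close> from monomials to polynomials. \<open>h\<close>
  may be any map, since the choice of a representative in each fibre and homogenization also occur
  as instances.\<close>

definition push :: "('a \<Rightarrow> 'b) \<Rightarrow> ('a \<Rightarrow>\<^sub>0 'k::comm_monoid_add) \<Rightarrow> ('b \<Rightarrow>\<^sub>0 'k)" where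
  "push h f = (\<Sum>u\<in>Poly_Mapping.keys f. Poly_Mapping.single (h u) (Poly_Mapping.lookup f u))"

text \<open>Exponents outside the support contribute zero terms. This allows polynomials with
  different supports to be summed over one index set.\<close>

lemma push_superset:
  assumes "finite A" "Poly_Mapping.keys f \<subseteq> A"
  shows "push h f = (\<Sum>u\<in>A. Poly_Mapping.single (h u) (Poly_Mapping.lookup f u))"
  unfolding push_def
  by (rule sum.mono_neutral_left) (use assms in \<open>auto simp: in_keys_iff\<close>)

lemma push_zero [simp]: "push h 0 = 0"
  by (simp add: push_def)

lemma push_single [simp]: "push h (Poly_Mapping.single u c) = Poly_Mapping.single (h u) c"
  by (simp add: push_def)

lemma push_add: "push h (f + g) = push h f + push h g"
proof -
  let ?A = "Poly_Mapping.keys f \<union> Poly_Mapping.keys g"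
  have "push h (f + g) = (\<Sum>u\<in>?A. Poly_Mapping.single (h u) (Poly_Mapping.lookup (f + g) u))"
    by (rule push_superset) (simp_all add: Poly_Mapping.keys_add)
  also have "\<dots> = push h f + push h g"
    by (simp add: push_superset[of ?A] lookup_add single_add sum.distrib)
  finally show ?thesis .
qed

lemma push_sum: "push h (\<Sum>i\<in>I. f i) = (\<Sum>i\<in>I. push h (f i))"
  by (induction I rule: infinite_finite_induct) (simp_all add: push_add)

lemma push_diff: "push h (f - g) = push h f - push h g"
  for f g :: "'a \<Rightarrow>\<^sub>0 'k::ab_group_add"
  using push_add[of h "f - g" g] by simp

lemma push_push: "push h (push g f) = push (h \<circ> g) f"
  by (simp add: push_def[of g f] push_def[of "h \<circ> g" f] push_sum)

lemma push_cong: "(\<And>u. u \<in> Poly_Mapping.keys f \<Longrightarrow> h u = g u) \<Longrightarrow> push h f = push g f"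
  by (simp add: push_def)

lemma push_id: "push (\<lambda>u. u) f = f"
proof (rule poly_mapping_eqI)
  fix k
  show "Poly_Mapping.lookup (push (\<lambda>u. u) f) k = Poly_Mapping.lookup f k"
    by (cases "k \<in> Poly_Mapping.keys f")
      (simp_all add: push_def lookup_sum lookup_single when_def in_keys_iff)
qed

text \<open>For additive \<open>h\<close> the map \<open>push h\<close> is multiplicative on single
  terms; \<open>push_id\<close> expands both factors into terms, and linearity does the
  rest.\<close>

lemma push_mult:
  fixes f g :: "'a::monoid_add \<Rightarrow>\<^sub>0 'k::semiring_0" and h :: "'a \<Rightarrow> 'b::monoid_add"
  assumes "\<And>u v. h (u + v) = h u + h v"
  shows "push h (f * g) = push h f * push h g"
proof -
  let ?S = "\<lambda>f::'a \<Rightarrow>\<^sub>0 'k. \<lambda>u. Poly_Mapping.single u (Poly_Mapping.lookup f u)"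
  have "push h (f * g) = push h (push (\<lambda>u. u) f * push (\<lambda>u. u) g)"
    by (simp add: push_id)
  also have "\<dots> = push h (\<Sum>u\<in>Poly_Mapping.keys f. \<Sum>v\<in>Poly_Mapping.keys g. ?S f u * ?S g v)"
    by (simp only: push_def[of "\<lambda>u. u"] sum_product)
  also have "\<dots> = push h f * push h g"
    by (simp add: push_sum mult_single assms push_def[of h f] push_def[of h g] sum_product)
  finally show ?thesis .
qed

section \<open>Toric ideals and indispensable binomials\<close>

definition toric_binomials :: "('a \<Rightarrow> 'g) \<Rightarrow> ('a \<Rightarrow>\<^sub>0 'k::comm_ring_1) set" where
  "toric_binomials deg =
     {Poly_Mapping.single m 1 - Poly_Mapping.single m' 1 | m m'. deg m = deg m'}"

lemma subspace_push_kernel: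
  fixes deg :: "'a::comm_monoid_add \<Rightarrow> 'g::comm_monoid_add"
  assumes "\<And>u v. deg (u + v) = deg u + deg v"
  shows "ideal.subspace {f :: 'a \<Rightarrow>\<^sub>0 'k::comm_ring_1. push deg f = 0}"
  by (simp add: ideal.subspace_def push_add push_mult assms)

text \<open>Moving every monomial of \<open>f\<close> to a fixed representative of its fibre changes
  \<open>f\<close> by a combination of binomials, and the moved polynomial vanishes when
  \<open>push deg f = 0\<close>.\<close>

lemma push_kernel_eq_span:
  fixes deg :: "'a::comm_monoid_add \<Rightarrow> 'g::comm_monoid_add"
  assumes "\<And>u v. deg (u + v) = deg u + deg v"
  shows "{f :: 'a \<Rightarrow>\<^sub>0 'k::comm_ring_1. push deg f = 0} = ideal.span (toric_binomials deg)"
proof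
  show "ideal.span (toric_binomials deg) \<subseteq> {f :: 'a \<Rightarrow>\<^sub>0 'k. push deg f = 0}"
    by (rule ideal.span_minimal)
      (auto simp: toric_binomials_def push_diff intro: subspace_push_kernel assms)
next
  show "{f :: 'a \<Rightarrow>\<^sub>0 'k. push deg f = 0} \<subseteq> ideal.span (toric_binomials deg)"
  proof
    fix f :: "'a \<Rightarrow>\<^sub>0 'k"
    assume "f \<in> {f. push deg f = 0}"
    then have f: "push deg f = 0" by simp
    \<comment> \<open>\<open>inv deg\<close> picks one preimage of each attained degree. As
      \<open>r\<close> factors through \<open>deg\<close>, \<open>push r\<close> kills everything
      that \<open>push deg\<close> kills.\<close>
    define r where "r = inv deg \<circ> deg"
    have deg_r: "deg (r u) = deg u" for u
      by (simp add: r_def f_inv_into_f)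
    have "push r f = 0"
      by (simp add: r_def push_push[symmetric] f)
    then have "f = push (\<lambda>u. u) f - push r f"
      by (simp add: push_id)
    also have "\<dots> = (\<Sum>u\<in>Poly_Mapping.keys f. Poly_Mapping.single 0 (Poly_Mapping.lookup f u) *
        (Poly_Mapping.single u 1 - Poly_Mapping.single (r u) 1))"
      by (simp add: push_def sum_subtractf[symmetric] right_diff_distrib mult_single)
    also have "\<dots> \<in> ideal.span (toric_binomials deg)"
      by (intro ideal.span_sum ideal.span_scale ideal.span_base)
        (use deg_r in \<open>force simp: toric_binomials_def\<close>)
    finally show "f \<in> ideal.span (toric_binomials deg)" .
  qed
qed

text \<open>The condition on \<open>r\<close> says that the whole fibre is the pair
  \<open>m\<close>, \<open>m'\<close>; the last condition says that the two monomials are coprime.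
  With each binomial the set contains its negative.\<close>

definition indispensable_binomials :: "(('v \<Rightarrow>\<^sub>0 nat) \<Rightarrow> 'g) \<Rightarrow> ('v, 'k::comm_ring_1) mpoly set" where
  "indispensable_binomials deg =
     {Poly_Mapping.single m 1 - Poly_Mapping.single m' 1 | m m'.
        m \<noteq> m' \<and> (\<forall>r. deg r = deg m \<longleftrightarrow> r = m \<or> r = m') \<and>
        (\<forall>v. Poly_Mapping.lookup m v = 0 \<or> Poly_Mapping.lookup m' v = 0)}"

lemma keys_binomial:
  assumes "m \<noteq> m'"
  shows "Poly_Mapping.keys (Poly_Mapping.single m (1::'k::comm_ring_1) - Poly_Mapping.single m' 1) = {m, m'}"
  using assms by (auto simp: in_keys_iff lookup_minus lookup_single when_def split: if_splits)

text \<open>Sums and multiples create no monomial outside the monomial ideal generated by all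
  monomials of the generators.\<close>

lemma span_key_multiple:
  fixes C :: "('a::comm_monoid_add \<Rightarrow>\<^sub>0 'k::comm_ring_1) set"
  assumes "f \<in> ideal.span C" "m \<in> Poly_Mapping.keys f"
  obtains c x q where "c \<in> C" "x \<in> Poly_Mapping.keys c" "m = q + x"
proof -
  \<comment> \<open>The polynomials all of whose monomials are divisible by a monomial of some
    element of \<open>C\<close>.\<close>
  define S where "S = {f :: 'a \<Rightarrow>\<^sub>0 'k. \<forall>k\<in>Poly_Mapping.keys f.
      \<exists>c\<in>C. \<exists>x\<in>Poly_Mapping.keys c. \<exists>q. k = q + x}"
  have "ideal.subspace S"
    unfolding ideal.subspace_def
  proof (intro conjI ballI allI)
    show "0 \<in> S" by (simp add: S_def)
  next
    fix f g assume "f \<in> S" "g \<in> S"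
    then show "f + g \<in> S"
      using Poly_Mapping.keys_add[of f g] by (auto simp: S_def)
  next
    fix r f assume f: "f \<in> S"
    show "r * f \<in> S"
      unfolding S_def
    proof (intro CollectI ballI)
      fix k assume "k \<in> Poly_Mapping.keys (r * f)"
      then obtain p l where "k = p + l" "l \<in> Poly_Mapping.keys f"
        using keys_mult by blast
      moreover from f this(2) obtain c x q where "c \<in> C" "x \<in> Poly_Mapping.keys c" "l = q + x"
        by (auto simp: S_def)
      ultimately show "\<exists>c\<in>C. \<exists>x\<in>Poly_Mapping.keys c. \<exists>q. k = q + x"
        by (metis add.assoc)
    qed
  qed
  moreover have "C \<subseteq> S"
  proof
    fix c assume "c \<in> C"
    then have "\<exists>c\<in>C. \<exists>x\<in>Poly_Mapping.keys c. \<exists>q. k = q + x" if "k \<in> Poly_Mapping.keys c" for k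
      using that by (intro bexI[of _ c] bexI[of _ k] exI[of _ 0]) simp_all
    then show "c \<in> S" by (simp add: S_def)
  qed
  ultimately have "f \<in> S"
    using assms(1) ideal.span_minimal by blast
  then show thesis
    using assms(2) that by (auto simp: S_def)
qed

text \<open>Some \<open>c\<close> in \<open>C\<close> has a monomial \<open>x\<close> dividing
  \<open>m\<close>. Since \<open>c\<close> is killed by \<open>push deg\<close>, it is a multiple of
  a difference \<open>x - y\<close> within one fibre; multiplying by the cofactor \<open>q\<close>
  gives the fibre of \<open>m\<close>, which leaves only \<open>m'\<close> for the second
  monomial.\<close>

lemma indispensable_binomial_in_generators:
  fixes deg :: "('v \<Rightarrow>\<^sub>0 nat) \<Rightarrow> 'g::comm_monoid_add" and C :: "('v, 'k::field) mpoly set"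
  assumes add: "\<And>u v. deg (u + v) = deg u + deg v"
    and C: "\<forall>c\<in>C. binomial_poly c" "ideal.span C = {f. push deg f = 0}"
    and g: "g \<in> indispensable_binomials deg"
  shows "\<exists>c\<in>C. \<exists>k. k \<noteq> 0 \<and> c = Poly_Mapping.single 0 k * g"
proof -
  obtain m m' where m: "g = Poly_Mapping.single m 1 - Poly_Mapping.single m' 1" "m \<noteq> m'"
    and fib: "\<And>r. deg r = deg m \<longleftrightarrow> r = m \<or> r = m'"
    and cop: "\<And>v. Poly_Mapping.lookup m v = 0 \<or> Poly_Mapping.lookup m' v = 0"
    using g unfolding indispensable_binomials_def by blast
  have "push deg g = 0"
    using fib[of m'] by (simp add: m push_diff)
  then have "g \<in> ideal.span C"
    using C(2) by simp
  moreover have "m \<in> Poly_Mapping.keys g"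
    using m by (simp add: keys_binomial)
  ultimately obtain c x q where c: "c \<in> C" and x: "x \<in> Poly_Mapping.keys c" and q: "m = q + x"
    by (rule span_key_multiple)
  have "card (Poly_Mapping.keys c) = 2"
    using C(1) c by (simp add: binomial_poly_def)
  then obtain y where keys: "Poly_Mapping.keys c = {x, y}" and xy: "x \<noteq> y"
    using x by (metis card_2_iff doubleton_eq_iff insert_iff singletonD)
  define \<alpha> \<beta> where "\<alpha> = Poly_Mapping.lookup c x" and "\<beta> = Poly_Mapping.lookup c y"
  have nz: "\<alpha> \<noteq> 0"
    using x by (simp add: \<alpha>_def in_keys_iff)
  have c_eq: "c = Poly_Mapping.single x \<alpha> + Poly_Mapping.single y \<beta>"
    using push_id[of c] xy by (simp add: push_def keys \<alpha>_def \<beta>_def)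
  have "push deg c = 0"
    using C(2) c ideal.span_base by blast
  then have p: "Poly_Mapping.single (deg x) \<alpha> + Poly_Mapping.single (deg y) \<beta> = 0"
    by (simp add: c_eq push_add)
  \<comment> \<open>In different degrees the two terms could not cancel, and the nonzero
    \<open>\<alpha>\<close> would survive.\<close>
  have deg: "deg x = deg y"
  proof (rule ccontr)
    assume "deg x \<noteq> deg y"
    then have "Poly_Mapping.lookup (Poly_Mapping.single (deg x) \<alpha> + Poly_Mapping.single (deg y) \<beta>) (deg x) = \<alpha>"
      by (simp add: lookup_add lookup_single)
    then show False using p nz by simp
  qed
  then have "Poly_Mapping.single (deg x) (\<alpha> + \<beta>) = 0"
    using p by (simp add: single_add)
  then have "\<alpha> + \<beta> = 0"
    by (metis lookup_single_eq lookup_zero)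
  then have \<beta>: "\<beta> = - \<alpha>"
    by (simp add: eq_neg_iff_add_eq_0 add.commute)
  have "deg (q + y) = deg m"
    by (simp add: q add deg)
  moreover have "q + y \<noteq> m"
    using xy q by simp
  ultimately have m': "m' = q + y"
    using fib by blast
  \<comment> \<open>\<open>q\<close> divides both \<open>m\<close> and \<open>m'\<close>, which are
    coprime.\<close>
  have "q = 0"
    by (rule poly_mapping_eqI) (use cop in \<open>fastforce simp: q m' lookup_add\<close>)
  then have "c = Poly_Mapping.single 0 \<alpha> * g"
    by (simp add: c_eq \<beta> m(1) q m' right_diff_distrib mult_single single_uminus)
  with c nz show ?thesis by blast
qed

section \<open>A criterion for unique presentation\<close>

text \<open>\<open>G\<close> may contain proportional elements, such as a binomial and its negative,
  so it need not be minimal. One representative per class of proportional elements gives the minimal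
  generating set \<open>B\<close>.\<close>

lemma uniquely_presentedI:
  fixes J :: "('v, 'k::field) mpoly set"
  assumes bin: "\<And>g. g \<in> G \<Longrightarrow> binomial_poly g"
    and span: "ideal.span G = J"
    and indisp: "\<And>C g. \<lbrakk>\<forall>c\<in>C. binomial_poly c; ideal.span C = J; g \<in> G\<rbrakk> \<Longrightarrow>
      \<exists>c\<in>C. \<exists>k. k \<noteq> 0 \<and> c = Poly_Mapping.single 0 k * g"
  shows "uniquely_presented J"
proof -
  define P where "P = (\<lambda>f g :: ('v, 'k) mpoly. \<exists>k. k \<noteq> 0 \<and> g = Poly_Mapping.single 0 k * f)"
  have refl: "P f f" for f
    unfolding P_def by (rule exI[of _ 1]) simp
  have sym: "P g f" if "P f g" for f g
  proof -
    obtain k where "k \<noteq> 0" "g = Poly_Mapping.single 0 k * f"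
      using \<open>P f g\<close> unfolding P_def by blast
    then have "f = Poly_Mapping.single 0 (inverse k) * g"
      by (simp add: mult.assoc[symmetric] mult_single)
    with \<open>k \<noteq> 0\<close> show ?thesis
      unfolding P_def by (metis inverse_nonzero_iff_nonzero)
  qed
  have trans: "P f h" if "P f g" "P g h" for f g h
  proof -
    obtain k l where "k \<noteq> 0" "g = Poly_Mapping.single 0 k * f" "l \<noteq> 0" "h = Poly_Mapping.single 0 l * g"
      using \<open>P f g\<close> \<open>P g h\<close> unfolding P_def by blast
    then have "l * k \<noteq> 0" "h = Poly_Mapping.single 0 (l * k) * f"
      by (simp_all add: mult.assoc[symmetric] mult_single)
    then show ?thesis
      unfolding P_def by blast
  qed
  have mults: "scalar_multiples B = {f. \<exists>b\<in>B. P b f}" for B :: "('v, 'k) mpoly set"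
    unfolding scalar_multiples_def P_def by blast
  have scale: "f \<in> ideal.span B" if "P b f" "b \<in> B" for b f B
    using that by (auto simp: P_def intro: ideal.span_scale ideal.span_base)
  have indisp': "\<exists>c\<in>C. P g c" if "\<forall>c\<in>C. binomial_poly c" "ideal.span C = J" "g \<in> G" for C g
    using indisp[OF that] by (simp add: P_def)
  \<comment> \<open>Proportional elements satisfy the same predicate under \<open>SOME\<close>, so
    the choice depends only on the class.\<close>
  define rep where "rep = (\<lambda>g. SOME h. h \<in> G \<and> P g h)"
  have rep: "rep g \<in> G" "P g (rep g)" if "g \<in> G" for g
    using someI[of "\<lambda>h. h \<in> G \<and> P g h" g] that refl by (simp_all add: rep_def)
  have rep_eq: "rep g = rep h" if "P g h" for g h
  proof -
    have "P g f \<longleftrightarrow> P h f" for f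
      using trans[of g h f] trans[of h g f] sym[of g h] that by auto
    then show ?thesis by (simp add: rep_def)
  qed
  define B where "B = rep ` G"
  have BG: "B \<subseteq> G"
    using rep(1) by (auto simp: B_def)
  have B_distinct: "b = c" if "b \<in> B" "c \<in> B" "P b c" for b c
  proof -
    obtain g h where g: "g \<in> G" "b = rep g" and h: "h \<in> G" "c = rep h"
      using \<open>b \<in> B\<close> \<open>c \<in> B\<close> by (auto simp: B_def)
    have "b = rep b" "c = rep c"
      using rep_eq[OF rep(2)] g h by simp_all
    then show ?thesis
      using rep_eq[OF \<open>P b c\<close>] by simp
  qed
  have spanB: "ideal.span B = J"
  proof (rule ideal.span_subspace)
    show "B \<subseteq> J"
      using BG span ideal.span_superset by blast
    have "G \<subseteq> ideal.span B"
      using rep(2) sym scale unfolding B_def by blast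
    then show "J \<subseteq> ideal.span B"
      using span ideal.span_minimal ideal.subspace_span by blast
    show "ideal.subspace J"
      using span ideal.subspace_span by blast
  qed
  have binB: "\<forall>b\<in>B. binomial_poly b"
    using BG bin by blast
  have minB: "minimal_binomial_generators J B"
    unfolding minimal_binomial_generators_def
  proof (intro conjI allI impI notI binB spanB)
    fix B' assume B': "B' \<subset> B" "ideal.span B' = J"
    then obtain b where b: "b \<in> B" "b \<notin> B'" by blast
    \<comment> \<open>A generating subset still contains a multiple of the omitted \<open>b\<close>;
      this multiple lies in \<open>B\<close>, where proportional elements are equal.\<close>
    obtain c where "c \<in> B'" "P b c"
      using indisp'[of B' b] B' b BG binB by blast
    then show False
      using B_distinct b B'(1) by blast
  qed
  have "scalar_multiples C = scalar_multiples B" if C: "minimal_binomial_generators J C" for C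
  proof -
    have C_bin: "\<forall>c\<in>C. binomial_poly c" and C_span: "ideal.span C = J"
      and C_min: "\<And>C'. C' \<subset> C \<Longrightarrow> ideal.span C' \<noteq> J"
      using C by (auto simp: minimal_binomial_generators_def)
    have BC: "\<exists>c\<in>C. P b c" if "b \<in> B" for b
      using indisp'[OF C_bin C_span] that BG by blast
    \<comment> \<open>The multiples of elements of \<open>B\<close> inside \<open>C\<close> already
      generate \<open>J\<close>, so minimality of \<open>C\<close> leaves nothing else in
      it.\<close>
    define C' where "C' = {c \<in> C. \<exists>b\<in>B. P b c}"
    have "ideal.span C' = J"
    proof (rule ideal.span_subspace)
      show "C' \<subseteq> J"
        using C_span ideal.span_superset by (auto simp: C'_def)
      have "B \<subseteq> ideal.span C'"
      proof
        fix b assume "b \<in> B"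
        moreover from this obtain c where "c \<in> C" "P b c"
          using BC by blast
        ultimately show "b \<in> ideal.span C'"
          by (intro scale[OF sym]) (auto simp: C'_def)
      qed
      then show "J \<subseteq> ideal.span C'"
        using spanB ideal.span_minimal ideal.subspace_span by blast
      show "ideal.subspace J"
        using span ideal.subspace_span by blast
    qed
    then have "C' = C"
      using C_min[of C'] by (auto simp: C'_def)
    then have "\<exists>b\<in>B. P b c" if "c \<in> C" for c
      using that by (auto simp: C'_def)
    with BC show ?thesis
      unfolding mults by (intro Collect_cong iffI; elim bexE) (meson sym trans)+
  qed
  with minB show ?thesis
    unfolding uniquely_presented_def by blast
qed

section \<open>The degree map of a degenerated Lawrence ideal\<close>

text \<open>The grading by the Lawrence lifting: \<open>x_i\<close> has degree
  \<open>(a i, e_i)\<close> and \<open>y_i\<close> has degree \<open>(0, e_i)\<close>, with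
  \<open>e_i\<close> the unit vectors.\<close>

definition lawrence_degree ::
    "('n::finite \<Rightarrow> int ^ 'd) \<Rightarrow> ('n + 'n \<Rightarrow>\<^sub>0 nat) \<Rightarrow> (int ^ 'd) \<times> (nat ^ 'n)" where
  "lawrence_degree a m =
     (\<Sum>i\<in>UNIV. int (Poly_Mapping.lookup m (Inl i)) *s a i,
      \<chi> i. Poly_Mapping.lookup m (Inl i) + Poly_Mapping.lookup m (Inr i))"

definition X_part :: "('v::finite option \<Rightarrow>\<^sub>0 nat) \<Rightarrow> ('v \<Rightarrow>\<^sub>0 nat)" where
  "X_part m = (\<Sum>i\<in>UNIV. Poly_Mapping.single i (Poly_Mapping.lookup m (Some i)))"

text \<open>Extends the grading by a weight coordinate, where \<open>X_i\<close> counts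
  \<open>w i\<close> and \<open>t\<close> counts 1; homogenizations are homogeneous in this
  coordinate.\<close>

definition degeneration_degree ::
    "(('v::finite \<Rightarrow>\<^sub>0 nat) \<Rightarrow> 'g) \<Rightarrow> ('v \<Rightarrow> nat) \<Rightarrow> ('v option \<Rightarrow>\<^sub>0 nat) \<Rightarrow> 'g \<times> nat" where
  "degeneration_degree deg w m =
     (deg (X_part m), exponent_weight w (X_part m) + Poly_Mapping.lookup m None)"

lemma lookup_X_part [simp]: "Poly_Mapping.lookup (X_part m) i = Poly_Mapping.lookup m (Some i)"
  by (simp add: X_part_def lookup_sum lookup_single when_def)

lemma lookup_Xt_exponent [simp]:
  "Poly_Mapping.lookup (Xt_exponent u k) (Some i) = Poly_Mapping.lookup u i"
  "Poly_Mapping.lookup (Xt_exponent u k) None = k"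
  by (simp_all add: Xt_exponent_def lookup_add lookup_sum lookup_single when_def)

lemma X_part_Xt_exponent [simp]: "X_part (Xt_exponent u k) = u"
  by (rule poly_mapping_eqI) simp

lemma Xt_exponent_X_part: "Xt_exponent (X_part m) (Poly_Mapping.lookup m None) = m"
proof (rule poly_mapping_eqI)
  show "Poly_Mapping.lookup (Xt_exponent (X_part m) (Poly_Mapping.lookup m None)) v = Poly_Mapping.lookup m v" for v
    by (cases v) simp_all
qed

lemma exponent_weight_add: "exponent_weight w (u + v) = exponent_weight w u + exponent_weight w v"
  by (simp add: exponent_weight_def lookup_add distrib_left sum.distrib)

lemma lawrence_degree_add: "lawrence_degree a (u + v) = lawrence_degree a u + lawrence_degree a v"
  by (simp add: lawrence_degree_def lookup_add sum.distrib vec_eq_iff vector_sadd_rdistrib)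

lemma degeneration_degree_add:
  assumes "\<And>u v. deg (u + v) = deg u + deg v"
  shows "degeneration_degree deg w (u + v) = degeneration_degree deg w u + degeneration_degree deg w v"
proof -
  have "X_part (u + v) = X_part u + X_part v"
    by (rule poly_mapping_eqI) (simp add: lookup_add)
  then show ?thesis
    by (simp add: degeneration_degree_def lookup_add assms exponent_weight_add)
qed

lemma exponent_weight_le_max_weight:
  "u \<in> Poly_Mapping.keys f \<Longrightarrow> exponent_weight w u \<le> max_weight w f"
  by (simp add: max_weight_def)

section \<open>Homogenization and the extended grading\<close>

lemma push_homogenize:
  assumes "push deg f = 0"
  shows "push (degeneration_degree deg w) (homogenize w f) = 0"
proof -
  have "push (degeneration_degree deg w) (homogenize w f) =
      push (degeneration_degree deg w)
        (push (\<lambda>u. Xt_exponent u (max_weight w f - exponent_weight w u)) f)"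
    by (simp add: homogenize_def push_def[of _ f])
  \<comment> \<open>The power of \<open>t\<close> lifts every term to total weight
    \<open>max_weight w f\<close>, so the new coordinate is constant on the support.\<close>
  also have "\<dots> = push ((\<lambda>d. (d, max_weight w f)) \<circ> deg) f"
    unfolding push_push
    by (rule push_cong) (simp add: degeneration_degree_def exponent_weight_le_max_weight)
  also have "\<dots> = 0"
    by (simp add: push_push[symmetric] assms)
  finally show ?thesis .
qed

lemma homogenize_binomial:
  assumes "m \<noteq> m'" "exponent_weight w m' \<le> exponent_weight w m"
  shows "homogenize w (Poly_Mapping.single m 1 - Poly_Mapping.single m' (1::'k::comm_ring_1)) =
    Poly_Mapping.single (Xt_exponent m 0) 1 -
    Poly_Mapping.single (Xt_exponent m' (exponent_weight w m - exponent_weight w m')) 1"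
proof -
  let ?f = "Poly_Mapping.single m 1 - Poly_Mapping.single m' (1::'k)"
  have "max_weight w ?f = exponent_weight w m"
    using assms by (simp add: max_weight_def keys_binomial max_def)
  then show ?thesis
    using assms
    by (simp add: homogenize_def keys_binomial lookup_minus lookup_single single_uminus)
qed

text \<open>Since \<open>u + v\<close> is constant on the fibres, two monomials without common factor are of the form
  \<open>x\<^sup>u y\<^sup>v\<close> and \<open>x\<^sup>v y\<^sup>u\<close>.\<close>

lemma lawrence_degree_coprime_swap:
  assumes deg: "lawrence_degree a m = lawrence_degree a m'"
    and cop: "\<And>v. Poly_Mapping.lookup m v = 0 \<or> Poly_Mapping.lookup m' v = 0"
  shows "Poly_Mapping.lookup m' (Inl i) = Poly_Mapping.lookup m (Inr i)"
    and "Poly_Mapping.lookup m' (Inr i) = Poly_Mapping.lookup m (Inl i)"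
proof -
  have "Poly_Mapping.lookup m (Inl i) + Poly_Mapping.lookup m (Inr i) =
      Poly_Mapping.lookup m' (Inl i) + Poly_Mapping.lookup m' (Inr i)"
    using deg by (simp add: lawrence_degree_def vec_eq_iff)
  then show "Poly_Mapping.lookup m' (Inl i) = Poly_Mapping.lookup m (Inr i)"
    and "Poly_Mapping.lookup m' (Inr i) = Poly_Mapping.lookup m (Inl i)"
    using cop[of "Inl i"] cop[of "Inr i"] by auto
qed

section \<open>Lawrence binomials and their homogenizations\<close>

lemma xy_monomial_eq:
  "xy_monomial (\<lambda>i. Poly_Mapping.lookup m (Inl i)) (\<lambda>i. Poly_Mapping.lookup m (Inr i)) =
    Poly_Mapping.single m 1"
proof -
  have "(\<Sum>i\<in>UNIV. Poly_Mapping.single (Inl i) (Poly_Mapping.lookup m (Inl i))) +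
      (\<Sum>i\<in>UNIV. Poly_Mapping.single (Inr i) (Poly_Mapping.lookup m (Inr i))) = m" (is "?s = m")
  proof (rule poly_mapping_eqI)
    show "Poly_Mapping.lookup ?s v = Poly_Mapping.lookup m v" for v
      by (cases v) (simp_all add: lookup_add lookup_sum lookup_single when_def)
  qed
  then show ?thesis by (simp add: xy_monomial_def)
qed

text \<open>By the swap of exponents, coprime monomials of equal degree form one of the defining
  generators of the ideal.\<close>

lemma lawrence_binomial_mem:
  assumes deg: "lawrence_degree a m = lawrence_degree a m'"
    and cop: "\<And>v. Poly_Mapping.lookup m v = 0 \<or> Poly_Mapping.lookup m' v = 0"
  shows "Poly_Mapping.single m (1::'k::comm_ring_1) - Poly_Mapping.single m' 1 \<in> lawrence_ideal a"
proof -
  let ?u = "\<lambda>i. Poly_Mapping.lookup m (Inl i)" and ?v = "\<lambda>i. Poly_Mapping.lookup m (Inr i)"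
  note swap = lawrence_degree_coprime_swap[OF deg cop]
  have "xy_monomial ?v ?u = Poly_Mapping.single m' (1::'k)"
    using xy_monomial_eq[of m'] by (simp add: swap)
  moreover have "(\<Sum>i\<in>UNIV. int (?u i) *s a i) = (\<Sum>i\<in>UNIV. int (?v i) *s a i)"
    using deg by (simp add: lawrence_degree_def swap)
  ultimately show ?thesis
    unfolding lawrence_ideal_def
    by - (rule ideal.span_base, rule CollectI, rule exI[of _ ?u], rule exI[of _ ?v],
      simp add: xy_monomial_eq)
qed

text \<open>Exchanging \<open>u\<close> and \<open>v\<close> preserves \<open>u + v\<close>, and the
  relation defining the generators preserves the first coordinate.\<close>

lemma push_lawrence_ideal:
  assumes "f \<in> lawrence_ideal a"
  shows "push (lawrence_degree a) f = 0"
proof -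
  have "lawrence_ideal a \<subseteq> {f. push (lawrence_degree a) f = 0}"
    unfolding lawrence_ideal_def
  proof (rule ideal.span_minimal)
    show "ideal.subspace {f. push (lawrence_degree a) f = 0}"
      by (intro subspace_push_kernel lawrence_degree_add)
  qed (auto simp: xy_monomial_def push_diff lawrence_degree_def lookup_add lookup_sum lookup_single
      when_def add.commute)
  with assms show ?thesis by blast
qed

text \<open>Up to sign, such a binomial is the homogenization of the Lawrence binomial obtained by
  deleting \<open>t\<close>.\<close>

lemma indispensable_mem_degeneration:
  fixes a :: "'n::finite \<Rightarrow> int ^ 'd::finite"
  shows "(indispensable_binomials (degeneration_degree (lawrence_degree a) w)
      :: (('n + 'n) option, 'k::comm_ring_1) mpoly set)
    \<subseteq> groebner_degeneration w (lawrence_ideal a)"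
proof
  let ?deg = "degeneration_degree (lawrence_degree a) w"
  let ?J = "groebner_degeneration w (lawrence_ideal a) :: (('n + 'n) option, 'k) mpoly set"
  have main: "Poly_Mapping.single m 1 - Poly_Mapping.single m' 1 \<in> ?J"
    if deg: "?deg m = ?deg m'" and ne: "m \<noteq> m'"
      and cop: "\<And>v. Poly_Mapping.lookup m v = 0 \<or> Poly_Mapping.lookup m' v = 0"
      and le: "exponent_weight w (X_part m') \<le> exponent_weight w (X_part m)" for m m'
  proof -
    \<comment> \<open>By coprimality \<open>t\<close> divides at most one of the monomials. As the
      total weights agree, it can divide only \<open>m'\<close>, whose \<open>X\<close>-part is no
      heavier, and it makes up the difference.\<close>
    have k: "Poly_Mapping.lookup m None = 0"
        "Poly_Mapping.lookup m' None = exponent_weight w (X_part m) - exponent_weight w (X_part m')"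
      using deg le cop[of None] by (auto simp: degeneration_degree_def)
    have ne': "X_part m \<noteq> X_part m'"
      using ne k Xt_exponent_X_part by (metis diff_self_eq_0)
    have "Poly_Mapping.single (X_part m) 1 - Poly_Mapping.single (X_part m') 1 \<in> lawrence_ideal a"
      using deg cop by (intro lawrence_binomial_mem) (simp_all add: degeneration_degree_def)
    then have "homogenize w (Poly_Mapping.single (X_part m) 1 - Poly_Mapping.single (X_part m') 1) \<in> ?J"
      unfolding groebner_degeneration_def by (intro ideal.span_base imageI)
    then show ?thesis
      using Xt_exponent_X_part[of m] Xt_exponent_X_part[of m']
      by (simp add: homogenize_binomial[OF ne' le] k)
  qed
  fix g :: "(('n + 'n) option, 'k) mpoly"
  assume "g \<in> indispensable_binomials ?deg"
  then obtain m m' where g: "g = Poly_Mapping.single m 1 - Poly_Mapping.single m' 1"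
    and m: "m \<noteq> m'" "?deg m' = ?deg m"
      "\<And>v. Poly_Mapping.lookup m v = 0 \<or> Poly_Mapping.lookup m' v = 0"
    unfolding indispensable_binomials_def by blast
  show "g \<in> ?J"
  proof (cases "exponent_weight w (X_part m') \<le> exponent_weight w (X_part m)")
    case True
    then show ?thesis
      using main[of m m'] m g by simp
  next
    case False
    then have "Poly_Mapping.single m' 1 - Poly_Mapping.single m 1 \<in> ?J"
      using main[of m' m] m by (metis nle_le)
    then have "- (Poly_Mapping.single m' 1 - Poly_Mapping.single m 1) \<in> ?J"
      unfolding groebner_degeneration_def by (rule ideal.span_neg)
    then show ?thesis
      by (simp add: g)
  qed
qed

section \<open>Generation of the toric ideal by descent on the distance within a fibre\<close>

definition x_distance :: "(('n + 'n) option \<Rightarrow>\<^sub>0 nat) \<Rightarrow> (('n::finite + 'n) option \<Rightarrow>\<^sub>0 nat) \<Rightarrow> nat" where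
  "x_distance m m' = (\<Sum>i\<in>UNIV. nat \<bar>int (Poly_Mapping.lookup m (Some (Inl i))) -
      int (Poly_Mapping.lookup m' (Some (Inl i)))\<bar>)"

text \<open>Within a fibre the \<open>x\<close>-exponents determine the \<open>y\<close>-exponents
  through their constant sums, and then the exponent of \<open>t\<close> through the weight.\<close>

lemma x_distance_eq_0:
  assumes deg: "degeneration_degree (lawrence_degree a) w m = degeneration_degree (lawrence_degree a) w m'"
    and 0: "x_distance m m' = 0"
  shows "m = m'"
proof -
  have x: "Poly_Mapping.lookup m (Some (Inl i)) = Poly_Mapping.lookup m' (Some (Inl i))" for i
    using 0 by (simp add: x_distance_def)
  have y: "Poly_Mapping.lookup m (Some (Inr i)) = Poly_Mapping.lookup m' (Some (Inr i))" for i
  proof -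
    have "Poly_Mapping.lookup m (Some (Inl i)) + Poly_Mapping.lookup m (Some (Inr i)) =
        Poly_Mapping.lookup m' (Some (Inl i)) + Poly_Mapping.lookup m' (Some (Inr i))"
      using deg by (simp add: degeneration_degree_def lawrence_degree_def vec_eq_iff)
    with x[of i] show ?thesis by simp
  qed
  have X: "X_part m = X_part m'"
  proof (rule poly_mapping_eqI)
    show "Poly_Mapping.lookup (X_part m) v = Poly_Mapping.lookup (X_part m') v" for v
      by (cases v) (simp_all add: x y)
  qed
  moreover from this have "Poly_Mapping.lookup m None = Poly_Mapping.lookup m' None"
    using deg by (simp add: degeneration_degree_def)
  ultimately show ?thesis
    by (metis Xt_exponent_X_part)
qed

text \<open>In each coordinate the \<open>x\<close>-exponents of \<open>p\<close> and
  \<open>p'\<close> are the two ends 0 and \<open>s\<close> of the range allowed by the common sum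
  \<open>s\<close>, so the exponent of \<open>r\<close> lies between them.\<close>

lemma x_distance_between:
  assumes deg: "degeneration_degree (lawrence_degree a) w p = degeneration_degree (lawrence_degree a) w p'"
      "degeneration_degree (lawrence_degree a) w r = degeneration_degree (lawrence_degree a) w p"
    and cop: "\<And>v. Poly_Mapping.lookup p v = 0 \<or> Poly_Mapping.lookup p' v = 0"
  shows "x_distance p r + x_distance r p' = x_distance p p'"
  unfolding x_distance_def sum.distrib[symmetric]
proof (rule sum.cong)
  fix i
  let ?l = "\<lambda>m s. Poly_Mapping.lookup m (Some s)"
  have "?l p (Inl i) + ?l p (Inr i) = ?l p' (Inl i) + ?l p' (Inr i)"
    "?l r (Inl i) + ?l r (Inr i) = ?l p (Inl i) + ?l p (Inr i)"
    using deg by (simp_all add: degeneration_degree_def lawrence_degree_def vec_eq_iff)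
  then show "nat \<bar>int (?l p (Inl i)) - int (?l r (Inl i))\<bar> + nat \<bar>int (?l r (Inl i)) - int (?l p' (Inl i))\<bar>
      = nat \<bar>int (?l p (Inl i)) - int (?l p' (Inl i))\<bar>"
    using cop[of "Some (Inl i)"] cop[of "Some (Inr i)"] by linarith
qed simp

lemma exponent_gcd:
  fixes m m' :: "'v::finite \<Rightarrow>\<^sub>0 nat"
  obtains q p p' where "m = q + p" "m' = q + p'"
    "\<And>v. Poly_Mapping.lookup p v = 0 \<or> Poly_Mapping.lookup p' v = 0"
proof
  let ?q = "\<Sum>v\<in>UNIV. Poly_Mapping.single v (min (Poly_Mapping.lookup m v) (Poly_Mapping.lookup m' v))"
  have q: "Poly_Mapping.lookup ?q v = min (Poly_Mapping.lookup m v) (Poly_Mapping.lookup m' v)" for v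
    by (simp add: lookup_sum lookup_single when_def)
  show "m = ?q + (m - ?q)" "m' = ?q + (m' - ?q)"
    by (rule poly_mapping_eqI; simp add: lookup_add lookup_minus q)+
  show "Poly_Mapping.lookup (m - ?q) v = 0 \<or> Poly_Mapping.lookup (m' - ?q) v = 0" for v
    by (simp add: lookup_minus q) linarith
qed

lemma degeneration_binomial_in_span:
  fixes a :: "'n::finite \<Rightarrow> int ^ 'd::finite"
  assumes "degeneration_degree (lawrence_degree a) w m = degeneration_degree (lawrence_degree a) w m'"
  shows "Poly_Mapping.single m 1 - Poly_Mapping.single m' 1 \<in>
    ideal.span (indispensable_binomials (degeneration_degree (lawrence_degree a) w)
      :: (('n + 'n) option, 'k::comm_ring_1) mpoly set)"
  using assms
proof (induction "x_distance m m'" arbitrary: m m' rule: less_induct)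
  case less
  let ?deg = "degeneration_degree (lawrence_degree a) w"
  let ?S = "ideal.span (indispensable_binomials ?deg) :: (('n + 'n) option, 'k) mpoly set"
  show ?case
  proof (cases "m = m'")
    case True
    then show ?thesis by (simp add: ideal.span_zero)
  next
    case False
    obtain q p p' where m: "m = q + p" "m' = q + p'"
      and cop: "\<And>v. Poly_Mapping.lookup p v = 0 \<or> Poly_Mapping.lookup p' v = 0"
      using exponent_gcd[of m m'] by metis
    have add: "?deg (u + v) = ?deg u + ?deg v" for u v
      by (intro degeneration_degree_add lawrence_degree_add)
    \<comment> \<open>The degrees lie in a cancellative monoid, so the degree of the common factor
      \<open>q\<close> can be removed.\<close>
    have deg: "?deg p = ?deg p'"
      using less.prems by (simp add: m add)
    have ne: "p \<noteq> p'"
      using False m by simp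
    have dist: "x_distance m m' = x_distance p p'"
      by (simp add: x_distance_def m lookup_add)
    have "Poly_Mapping.single p 1 - Poly_Mapping.single p' 1 \<in> ?S"
    proof (cases "\<forall>r. ?deg r = ?deg p \<longleftrightarrow> r = p \<or> r = p'")
      case True
      then have "Poly_Mapping.single p 1 - Poly_Mapping.single p' (1::'k) \<in> indispensable_binomials ?deg"
        using ne cop unfolding indispensable_binomials_def by blast
      then show ?thesis by (rule ideal.span_base)
    next
      case False
      \<comment> \<open>The pair \<open>p\<close>, \<open>p'\<close> lies in one fibre, so the
        equivalence can fail only through a third point.\<close>
      then obtain r where r: "?deg r = ?deg p" "r \<noteq> p" "r \<noteq> p'"
        using deg by metis
      have "x_distance p r + x_distance r p' = x_distance m m'"
        using x_distance_between[OF deg r(1) cop] dist by simp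
      \<comment> \<open>Both summands are positive, hence both are smaller than the total, and the
        induction hypothesis applies to each half.\<close>
      moreover have "x_distance p r \<noteq> 0" "x_distance r p' \<noteq> 0"
        using x_distance_eq_0 r deg by metis+
      ultimately have "Poly_Mapping.single p 1 - Poly_Mapping.single r 1 \<in> ?S"
        "Poly_Mapping.single r 1 - Poly_Mapping.single p' 1 \<in> ?S"
        using less.hyps r(1) deg by auto
      from ideal.span_add[OF this] show ?thesis by simp
    qed
    then have "Poly_Mapping.single q 1 * (Poly_Mapping.single p 1 - Poly_Mapping.single p' 1) \<in> ?S"
      by (rule ideal.span_scale)
    then show ?thesis
      by (simp add: m right_diff_distrib mult_single)
  qed
qed

lemma push_kernel_subset_span_indispensable:
  fixes a :: "'n::finite \<Rightarrow> int ^ 'd::finite"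
  shows "{f. push (degeneration_degree (lawrence_degree a) w) f = 0} \<subseteq>
    ideal.span (indispensable_binomials (degeneration_degree (lawrence_degree a) w)
      :: (('n + 'n) option, 'k::comm_ring_1) mpoly set)"
proof -
  let ?deg = "degeneration_degree (lawrence_degree a) w"
  have "toric_binomials ?deg \<subseteq>
      (ideal.span (indispensable_binomials ?deg) :: (('n + 'n) option, 'k) mpoly set)"
    using degeneration_binomial_in_span unfolding toric_binomials_def by blast
  then show ?thesis
    unfolding push_kernel_eq_span[OF degeneration_degree_add[OF lawrence_degree_add]]
    by (rule ideal.span_minimal) (rule ideal.subspace_span)
qed

lemma groebner_degeneration_subset_push_kernel:
  "groebner_degeneration w (lawrence_ideal a) \<subseteq>
    {f. push (degeneration_degree (lawrence_degree a) w) f = 0}"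
  unfolding groebner_degeneration_def
proof (rule ideal.span_minimal)
  show "homogenize w ` lawrence_ideal a \<subseteq> {f. push (degeneration_degree (lawrence_degree a) w) f = 0}"
    using push_homogenize push_lawrence_ideal by blast
  show "ideal.subspace {f. push (degeneration_degree (lawrence_degree a) w) f = 0}"
    by (intro subspace_push_kernel degeneration_degree_add lawrence_degree_add)
qed

theorem corollary4p14:
  fixes a :: "'n::finite \<Rightarrow> int ^ 'd::finite"
    and w :: "'n + 'n \<Rightarrow> nat"
  assumes "affine_semigroup (add_submonoid hull range a)"
    and "pointed (add_submonoid hull range a)"
  shows "uniquely_presented
    (groebner_degeneration w (lawrence_ideal a :: ('n + 'n, 'k::field) mpoly set))"
proof -
  let ?deg = "degeneration_degree (lawrence_degree a) w"
  let ?G = "indispensable_binomials ?deg :: (('n + 'n) option, 'k) mpoly set"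
  let ?J = "groebner_degeneration w (lawrence_ideal a :: ('n + 'n, 'k) mpoly set)"
  have "ideal.span ?G \<subseteq> ?J"
    unfolding groebner_degeneration_def
    by (intro ideal.span_minimal ideal.subspace_span
        indispensable_mem_degeneration[unfolded groebner_degeneration_def])
  \<comment> \<open>The inclusions of \<open>ideal.span ?G\<close> in \<open>?J\<close>, of
    \<open>?J\<close> in the kernel and of the kernel in \<open>ideal.span ?G\<close> close a
    circle, so all three ideals coincide.\<close>
  then have span: "ideal.span ?G = ?J" and ker: "?J = {f. push ?deg f = 0}"
    using push_kernel_subset_span_indispensable[of a w]
      groebner_degeneration_subset_push_kernel[of w a] by blast+
  show ?thesis
  proof (rule uniquely_presentedI[OF _ span])
    show "binomial_poly g" if "g \<in> ?G" for g
      using that by (auto simp: indispensable_binomials_def binomial_poly_def keys_binomial)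
  next
    fix C g assume "\<forall>c\<in>C. binomial_poly c" "ideal.span C = ?J" "g \<in> ?G"
    then show "\<exists>c\<in>C. \<exists>k. k \<noteq> 0 \<and> c = Poly_Mapping.single 0 k * g"
      unfolding ker
      by (rule indispensable_binomial_in_generators[OF degeneration_degree_add[OF lawrence_degree_add]])
  qed
qed

end
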